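(* Let $\mathcal{D}\subset\mathbb{R}^d$ be compact and convex, let $\mathcal{M}=\{\mathsf{OCO}_1,\dots,\mathsf{OCO}_K\}$ be gradient-based optimizers on $\mathcal{D}$ and let $\mathcal{A}$ be an expert advice algorithm on $K$ experts. Let $f_1,\dots,f_T$ be the convex cost functions incurred in the Master OCO Framework run with $\mathcal{A}$ and $\mathcal{M}$. Then for every $i\in\{1,\dots,K\}$, the regret of the framework satisfies $$\mathcal{R}_T\le 2F\cdot\mathcal{R}_T^{\mathcal{A}}+\mathcal{R}_T^{\mathsf{OCO}_i},$$ where $F$ is the tight upper bound for all surrogate cost functions, $\mathcal{R}_T^{\mathsf{OCO}_i}$ is the regret of the $i$-th optimizer on the surrogate cost functions, and $\mathcal{R}_T^{\mathcal{A}}$ is the regret of the expert advice algorithm $\mathcal{A}$.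
   Context: Online convex optimization: at each round $t$ a point $x_t\in\mathcal{D}$ is played and then a convex (differentiable) cost function $f_t$ is revealed; $\mathcal{R}_T=\sum_{t=1}^T f_t(x_t)-\min_{x\in\mathcal{D}}\sum_{t=1}^T f_t(x)$. Write $\nabla_t=\nabla f_t(x_t)$ and $\widehat f_t(x)=\langle\nabla_t,x\rangle$ (surrogate cost). $F=\sup_{t\le T,\;x,y\in\mathcal{D}}|\langle\nabla f_t(y),x\rangle|$, assumed $0<F<\infty$. A gradient-based optimizer is an algorithm whose iterates are produced by a rule $x_t=\Psi(x_{t-1},\nabla_{1:t-1})\in\mathcal{D}$ using only the previous point and past gradients supplied to it. An expert advice algorithm on $K$ experts selects at each round $t$ an expert $a_t\in\{1,\dots,K\}$ (based on a distribution $p_t$ computed from past observed losses) and then observes losses in $[0,1]$: either all $\ell_t(1),\dots,\ell_t(K)$ (full feedback) or only $\ell_t(a_t)$ (partial feedback). Its regret is $\mathcal{R}_T^{\mathcal{A}}=\sum_{t=1}^T\ell_t(a_t)-\min_{a\in\{1,\dots,K\}}\sum_{t=1}^T\ell_t(a)$. Master OCO Framework. For $t=1,\dots,T$: (1) $\mathcal{A}$ selects $a_t\in\{1,\dots,K\}$; (2) play $x_t=x_t^{a_t}$, where $x_t^{i}\in\mathcal{D}$ denotes the point predicted by $\mathsf{OCO}_i$ at round $t$, and the cost $f_t$ is revealed; (3) pass the surrogate cost $\widehat f_t$ (i.e. the gradient $\nabla_t$) to all optimizers; (4) set $\ell_t(i)=\frac{\widehat f_t(x_t^i)}{2F}+\frac12$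 for all $i$ and pass to $\mathcal{A}$ all the $\ell_t(i)$ (full feedback) or only $\ell_t(a_t)$ (partial feedback); $\mathcal{A}$ then updates. $\mathcal{R}_T^{\mathsf{OCO}_i}=\sum_{t=1}^T\widehat f_t(x_t^i)-\min_{x\in\mathcal{D}}\sum_{t=1}^T\widehat f_t(x)$. *)

theory Defs
  imports "HOL-Analysis.Analysis" "HOL-Probability.Probability_Mass_Function"
begin

(* The minimum of h over D. The value is only meaningful if it is attained, which is the case
   below: D is compact and nonempty, and the functions minimised are continuous on D. *)
definition min_over :: "'a set \<Rightarrow> ('a \<Rightarrow> real) \<Rightarrow> real" where
  "min_over D h = (LEAST v. v \<in> h ` D)"

definition oco_regret :: "'a set \<Rightarrow> nat \<Rightarrow> (nat \<Rightarrow> 'a \<Rightarrow> real) \<Rightarrow> (nat \<Rightarrow> 'a) \<Rightarrow> real" where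
  "oco_regret D T c x = (\<Sum>t=1..T. c t (x t)) - min_over D (\<lambda>y. \<Sum>t=1..T. c t y)"

(* The loss of expert i at round t is l t i. *)
definition expert_regret :: "nat \<Rightarrow> nat \<Rightarrow> (nat \<Rightarrow> nat \<Rightarrow> real) \<Rightarrow> (nat \<Rightarrow> nat) \<Rightarrow> real" where
  "expert_regret K T l a =
     (\<Sum>t=1..T. l t (a t)) - Min ((\<lambda>b. \<Sum>t=1..T. l t b) ` {1..K})"

(* The rule Psi is the update function; it is applied to the previous point and the list of all
   past gradients. The seed plays the role of x_0, so that x_1 = Psi(x_0, []). *)
datatype 'a optimizer = Optimizer (seed: 'a) (update: "'a \<Rightarrow> 'a list \<Rightarrow> 'a")

primrec iterate :: "'a optimizer \<Rightarrow> 'a list \<Rightarrow> nat \<Rightarrow> 'a" where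
  "iterate opt gs 0 = seed opt"
| "iterate opt gs (Suc t) = update opt (iterate opt gs t) (take t gs)"

(* If gs lists the gradients of rounds 1, ..., t - 1, this is the point x_t. *)
definition next_point :: "'a optimizer \<Rightarrow> 'a list \<Rightarrow> 'a" where
  "next_point opt gs = iterate opt gs (Suc (length gs))"

definition gradient_based_optimizer :: "'a set \<Rightarrow> 'a optimizer \<Rightarrow> bool" where
  "gradient_based_optimizer D opt \<longleftrightarrow> (\<forall>gs. next_point opt gs \<in> D)"

(* A round is recorded as the selected expert together with the losses that were revealed, a
   partial function on experts. An expert advice algorithm maps the record of the past rounds
   to the distribution from which the next expert is drawn. *)
type_synonym expert_history = "(nat \<times> (nat \<rightharpoonup> real)) list"

datatype feedback = Full | Partial

fun observed :: "feedback \<Rightarrow> nat \<Rightarrow> (nat \<Rightarrow> real) \<Rightarrow> nat \<Rightarrow> (nat \<rightharpoonup> real)" where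
  "observed Full K l b = (\<lambda>i. if i \<in> {1..K} then Some (l i) else None)"
| "observed Partial K l b = [b \<mapsto> l b]"

definition expert_algorithm :: "nat \<Rightarrow> (expert_history \<Rightarrow> nat pmf) \<Rightarrow> bool" where
  "expert_algorithm K A \<longleftrightarrow>
     (\<forall>h. (\<forall>(b, l) \<in> set h. b \<in> {1..K} \<and> ran l \<subseteq> {0..1}) \<longrightarrow> set_pmf (A h) \<subseteq> {1..K})"

(* A gradient of a function given on D only. It is unique if D has nonempty interior, and the
   usual gradient of a function differentiable on a neighbourhood of D is an instance. *)
definition gradient_on :: "'a::real_inner set \<Rightarrow> ('a \<Rightarrow> real) \<Rightarrow> ('a \<Rightarrow> 'a) \<Rightarrow> bool" where
  "gradient_on D c g \<longleftrightarrow> (\<forall>y\<in>D. (c has_derivative (\<lambda>h. g y \<bullet> h)) (at y within D))"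

(* The set whose supremum is F. Throughout, G t is the gradient map of the cost function of
   round t. *)
definition surrogate_magnitudes :: "'a::real_inner set \<Rightarrow> nat \<Rightarrow> (nat \<Rightarrow> 'a \<Rightarrow> 'a) \<Rightarrow> real set" where
  "surrogate_magnitudes D T G = {\<bar>G t y \<bullet> x\<bar> | t x y. t \<in> {1..T} \<and> x \<in> D \<and> y \<in> D}"

(* The run of the framework with optimizers M 1, ..., M K, once the selections a 1, a 2, ... of
   the expert algorithm are given. The first function lists the gradients passed to the
   optimizers in rounds 1, ..., t. *)
primrec past_gradients ::
  "(nat \<Rightarrow> 'a optimizer) \<Rightarrow> (nat \<Rightarrow> 'a \<Rightarrow> 'a) \<Rightarrow> (nat \<Rightarrow> nat) \<Rightarrow> nat \<Rightarrow> 'a list" where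
  "past_gradients M G a 0 = []"
| "past_gradients M G a (Suc t) =
     (let gs = past_gradients M G a t in gs @ [G (Suc t) (next_point (M (a (Suc t))) gs)])"

definition expert_point ::
  "(nat \<Rightarrow> 'a optimizer) \<Rightarrow> (nat \<Rightarrow> 'a \<Rightarrow> 'a) \<Rightarrow> (nat \<Rightarrow> nat) \<Rightarrow> nat \<Rightarrow> nat \<Rightarrow> 'a" where
  "expert_point M G a i t = next_point (M i) (past_gradients M G a (t - 1))"

definition played_point ::
  "(nat \<Rightarrow> 'a optimizer) \<Rightarrow> (nat \<Rightarrow> 'a \<Rightarrow> 'a) \<Rightarrow> (nat \<Rightarrow> nat) \<Rightarrow> nat \<Rightarrow> 'a" where
  "played_point M G a t = expert_point M G a (a t) t"

definition surrogate_cost ::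
  "(nat \<Rightarrow> 'a::real_inner optimizer) \<Rightarrow> (nat \<Rightarrow> 'a \<Rightarrow> 'a) \<Rightarrow> (nat \<Rightarrow> nat) \<Rightarrow> nat \<Rightarrow> 'a \<Rightarrow> real" where
  "surrogate_cost M G a t x = G t (played_point M G a t) \<bullet> x"

definition expert_loss ::
  "(nat \<Rightarrow> 'a::real_inner optimizer) \<Rightarrow> (nat \<Rightarrow> 'a \<Rightarrow> 'a) \<Rightarrow> real \<Rightarrow> (nat \<Rightarrow> nat)
     \<Rightarrow> nat \<Rightarrow> nat \<Rightarrow> real" where
  "expert_loss M G F a t i =
     surrogate_cost M G a t (expert_point M G a i t) / (2 * F) + 1 / 2"

(* What the expert algorithm has seen after n rounds. *)
definition history ::
  "feedback \<Rightarrow> nat \<Rightarrow> (nat \<Rightarrow> 'a::real_inner optimizer) \<Rightarrow> (nat \<Rightarrow> 'a \<Rightarrow> 'a) \<Rightarrow> real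
     \<Rightarrow> (nat \<Rightarrow> nat) \<Rightarrow> nat \<Rightarrow> expert_history" where
  "history fb K M G F a n =
     map (\<lambda>t. (a t, observed fb K (expert_loss M G F a t) (a t))) [1..<Suc n]"

(* The selections a 1, ..., a T form a possible outcome of the random draws of A. Note that
   the history after t - 1 rounds depends only on the selections before round t. *)
definition master_run ::
  "feedback \<Rightarrow> nat \<Rightarrow> nat \<Rightarrow> (expert_history \<Rightarrow> nat pmf) \<Rightarrow> (nat \<Rightarrow> 'a::real_inner optimizer)
     \<Rightarrow> (nat \<Rightarrow> 'a \<Rightarrow> 'a) \<Rightarrow> real \<Rightarrow> (nat \<Rightarrow> nat) \<Rightarrow> bool" where
  "master_run fb K T A M G F a \<longleftrightarrow>
     (\<forall>t\<in>{1..T}. a t \<in> set_pmf (A (history fb K M G F a (t - 1))))"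

end

theory Submission imports Defs begin

text \<open>By convexity, replacing each cost by its linearization at the played point only increases regret,
  so the regret of the framework is bounded by the regret of the played points on the surrogate
  costs. Undoing the affine rescaling to \<open>[0, 1]\<close>, the surrogate cost of the played points exceeds
  that of the points of any single optimizer by at most \<open>2 F\<close> times the expert regret. The draws
  of the expert algorithm lie in \<open>{1..K}\<close> because, by induction on the round, all losses revealed
  to it lie in \<open>[0, 1]\<close>; this puts the played points in \<open>D\<close>.\<close>

text \<open>Compactness and continuity make the \<open>LEAST\<close> in \<open>min_over\<close> a
  genuine minimum; its minimizer is exposed so that it can serve as a comparator.\<close>

lemma min_over_attained:
  fixes h :: "'a::topological_space \<Rightarrow> real"
  assumes "compact D" "D \<noteq> {}" "continuous_on D h"
  obtains x where "x \<in> D" "min_over D h = h x" "\<And>y. y \<in> D \<Longrightarrow> h x \<le> h y"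
proof -
  obtain x where x: "x \<in> D" "\<forall>y\<in>D. h x \<le> h y"
    using continuous_attains_inf[OF assms] by blast
  have "min_over D h = h x"
    unfolding min_over_def by (rule Least_equality) (use x in auto)
  with x that show thesis by blast
qed

text \<open>The derivative of \<open>f\<close> is known only within \<open>D\<close>, so it is
  restricted to the segment from \<open>x\<close> to \<open>y\<close>. By convexity the difference
  quotients at \<open>x\<close> along this segment are at most \<open>f y - f x\<close>, and they
  tend to \<open>g x \<bullet> (y - x)\<close>.\<close>

lemma convex_on_gradient_ineq:
  assumes f: "convex_on D f" and g: "gradient_on D f g" and x: "x \<in> D" and y: "y \<in> D"
  shows "f x - f y \<le> g x \<bullet> x - g x \<bullet> y"
proof -
  let ?p = "\<lambda>s. x + s *\<^sub>R (y - x)"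
  have D: "convex D" using f by (simp add: convex_on_def)
  have p: "?p s = (1 - s) *\<^sub>R x + s *\<^sub>R y" for s by (simp add: algebra_simps)
  have sub: "?p ` {0..1} \<subseteq> D"
    using D x y by (auto simp: p convex_alt)
  have "(f has_derivative (\<lambda>h. g x \<bullet> h)) (at (?p 0) within ?p ` {0..1})"
    using g x sub by (auto simp: gradient_on_def intro: has_derivative_subset)
  moreover have "(?p has_derivative (\<lambda>s. s *\<^sub>R (y - x))) (at 0 within {0..1})"
    by (auto intro!: derivative_eq_intros)
  ultimately have "((\<lambda>s. f (?p s)) has_derivative (\<lambda>s. g x \<bullet> (s *\<^sub>R (y - x)))) (at 0 within {0..1})"
    by (rule has_derivative_in_compose[rotated])
  then have "((\<lambda>s. f (?p s)) has_field_derivative g x \<bullet> (y - x)) (at 0 within {0..1})"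
    by (simp add: has_field_derivative_def mult.commute[of _ "g x \<bullet> (y - x)"])
  then have lim: "((\<lambda>s. (f (?p s) - f x) / s) \<longlongrightarrow> g x \<bullet> (y - x)) (at 0 within {0..1})"
    by (simp add: has_field_derivative_iff)
  have "(f (?p s) - f x) / s \<le> f y - f x" if "s \<in> {0..1}" "s \<noteq> 0" for s
  proof -
    have "f (?p s) \<le> (1 - s) * f x + s * f y"
      unfolding p using convex_onD[OF f, of s x y] that x y by simp
    then show ?thesis using that by (simp add: field_simps)
  qed
  then have "\<forall>\<^sub>F s in at 0 within {0..1}. (f (?p s) - f x) / s \<le> f y - f x"
    by (auto simp: eventually_at_filter)
  \<comment> \<open>The bound on the quotients passes to the limit only along a nontrivial
    filter.\<close>
  moreover have "at (0::real) within {0..1} \<noteq> bot"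
    by (simp add: at_within_Icc_at_right)
  ultimately have "g x \<bullet> (y - x) \<le> f y - f x"
    using lim by (intro tendsto_upperbound)
  then show ?thesis by (simp add: inner_diff_right)
qed

lemma expert_point_in:
  "gradient_based_optimizer D (M i) \<Longrightarrow> expert_point M G a i t \<in> D"
  by (simp add: gradient_based_optimizer_def expert_point_def)

lemma surrogate_magnitude_le:
  assumes "bdd_above (surrogate_magnitudes D T G)" "t \<in> {1..T}" "x \<in> D" "y \<in> D"
  shows "\<bar>G t y \<bullet> x\<bar> \<le> Sup (surrogate_magnitudes D T G)"
  using assms by (intro cSup_upper) (auto simp: surrogate_magnitudes_def)

text \<open>Both the played point and the point of expert \<open>i\<close> lie in \<open>D\<close>,
  so the surrogate value lies in \<open>{-F..F}\<close>, which the rescaling maps to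
  \<open>{0..1}\<close>.\<close>

lemma expert_loss_unit_interval:
  assumes "bdd_above (surrogate_magnitudes D T G)" "F = Sup (surrogate_magnitudes D T G)" "0 < F"
    and "t \<in> {1..T}"
    and "gradient_based_optimizer D (M (a t))" "gradient_based_optimizer D (M i)"
  shows "expert_loss M G F a t i \<in> {0..1}"
proof -
  have "\<bar>surrogate_cost M G a t (expert_point M G a i t)\<bar> \<le> F"
    using surrogate_magnitude_le[OF assms(1,4)] assms(2,5,6)
    by (simp add: surrogate_cost_def played_point_def expert_point_in)
  with \<open>0 < F\<close> show ?thesis
    by (auto simp: expert_loss_def abs_le_iff field_simps)
qed

lemma ran_observed:
  "b \<in> {1..K} \<Longrightarrow> ran (observed fb K l b) \<subseteq> l ` {1..K}"
  by (cases fb) (auto simp: ran_def split: if_splits)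

lemma master_run_selection:
  assumes opt: "\<And>j. j \<in> {1..K} \<Longrightarrow> gradient_based_optimizer D (M j)"
    and A: "expert_algorithm K A"
    and F: "bdd_above (surrogate_magnitudes D T G)" "F = Sup (surrogate_magnitudes D T G)" "0 < F"
    and run: "master_run fb K T A M G F a"
  shows "t \<in> {1..T} \<Longrightarrow> a t \<in> {1..K}"
proof (induction t rule: less_induct)
  case (less t)
  \<comment> \<open>The induction hypothesis makes \<open>a s\<close> a valid expert, hence the
    point played in round \<open>s\<close> lies in \<open>D\<close> and \<open>F\<close> bounds its
    surrogate cost.\<close>
  have "a s \<in> {1..K} \<and> ran (observed fb K (expert_loss M G F a s) (a s)) \<subseteq> {0..1}"
    if "s \<in> {1..<t}" for s
  proof -
    have s: "s \<in> {1..T}" and as: "a s \<in> {1..K}" using less that by auto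
    have "expert_loss M G F a s j \<in> {0..1}" if "j \<in> {1..K}" for j
      using expert_loss_unit_interval[OF F s] opt as that by blast
    then have "expert_loss M G F a s ` {1..K} \<subseteq> {0..1}" by (rule image_subsetI)
    with ran_observed[OF as] have "ran (observed fb K (expert_loss M G F a s) (a s)) \<subseteq> {0..1}"
      by (rule subset_trans)
    with as show ?thesis ..
  qed
  then have "\<forall>(b, l) \<in> set (history fb K M G F a (t - 1)). b \<in> {1..K} \<and> ran l \<subseteq> {0..1}"
    using less.prems by (auto simp: history_def)
  with A have "set_pmf (A (history fb K M G F a (t - 1))) \<subseteq> {1..K}"
    by (simp add: expert_algorithm_def)
  with run less.prems show ?case unfolding master_run_def by blast
qed

lemma oco_regret_le_linearized:
  fixes c :: "nat \<Rightarrow> 'a::real_inner \<Rightarrow> real"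
  assumes "compact D" and "D \<noteq> {}"
    and conv: "\<And>t. t \<in> {1..T} \<Longrightarrow> convex_on D (c t)"
    and grad: "\<And>t. t \<in> {1..T} \<Longrightarrow> gradient_on D (c t) (G t)"
    and x: "\<And>t. t \<in> {1..T} \<Longrightarrow> x t \<in> D"
  shows "oco_regret D T c x \<le> oco_regret D T (\<lambda>t y. G t (x t) \<bullet> y) x"
proof -
  have "continuous_on D (c t)" if "t \<in> {1..T}" for t
  proof (rule has_derivative_continuous_on)
    show "(c t has_derivative (\<lambda>h. G t y \<bullet> h)) (at y within D)" if "y \<in> D" for y
      using grad[OF \<open>t \<in> {1..T}\<close>] that unfolding gradient_on_def by blast
  qed
  then have "continuous_on D (\<lambda>y. \<Sum>t=1..T. c t y)" by (intro continuous_on_sum)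
  \<comment> \<open>The minimizer \<open>z\<close> of the true total cost is the comparator on both
    sides; the linearized minimum can only be smaller than the linearized total at
    \<open>z\<close>.\<close>
  then obtain z where z: "z \<in> D" "min_over D (\<lambda>y. \<Sum>t=1..T. c t y) = (\<Sum>t=1..T. c t z)"
    using min_over_attained assms(1,2) by blast
  have "continuous_on D (\<lambda>y. \<Sum>t=1..T. G t (x t) \<bullet> y)" by (intro continuous_intros)
  then have w: "min_over D (\<lambda>y. \<Sum>t=1..T. G t (x t) \<bullet> y) \<le> (\<Sum>t=1..T. G t (x t) \<bullet> z)"
    by (rule min_over_attained[OF assms(1,2)]) (use z(1) in simp)
  have "(\<Sum>t=1..T. c t (x t) - c t z) \<le> (\<Sum>t=1..T. G t (x t) \<bullet> x t - G t (x t) \<bullet> z)"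
    by (intro sum_mono convex_on_gradient_ineq[OF conv grad x z(1)])
  with z(2) w show ?thesis by (simp add: oco_regret_def sum_subtractf)
qed

theorem proposition3p2:
  fixes D :: "(real ^ 'd) set"
    and K T i :: nat
    and M :: "nat \<Rightarrow> (real ^ 'd) optimizer"
    and A :: "expert_history \<Rightarrow> nat pmf"
    and fb :: feedback
    and f :: "nat \<Rightarrow> real ^ 'd \<Rightarrow> real"
    and G :: "nat \<Rightarrow> real ^ 'd \<Rightarrow> real ^ 'd"
    and F :: real
    and a :: "nat \<Rightarrow> nat"
  assumes "compact D" and "convex D"
    and "\<And>j. j \<in> {1..K} \<Longrightarrow> gradient_based_optimizer D (M j)"
    and "expert_algorithm K A"
    and "\<And>t. t \<in> {1..T} \<Longrightarrow> convex_on D (f t)"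
    and "\<And>t. t \<in> {1..T} \<Longrightarrow> gradient_on D (f t) (G t)"
    and "bdd_above (surrogate_magnitudes D T G)"
    and "F = Sup (surrogate_magnitudes D T G)" and "0 < F"
    and "master_run fb K T A M G F a"
    and "i \<in> {1..K}"
  shows "oco_regret D T f (played_point M G a)
           \<le> 2 * F * expert_regret K T (expert_loss M G F a) a
             + oco_regret D T (surrogate_cost M G a) (expert_point M G a i)"
proof -
  let ?x = "played_point M G a" and ?l = "expert_loss M G F a" and ?s = "surrogate_cost M G a"
  have "?x t \<in> D" if "t \<in> {1..T}" for t
    using master_run_selection[OF assms(3,4,7-10) that] assms(3)
    by (simp add: played_point_def expert_point_in)
  moreover have "D \<noteq> {}" using expert_point_in assms(3,11) by blast
  ultimately have "oco_regret D T f ?x \<le> oco_regret D T ?s ?x"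
    using oco_regret_le_linearized[OF assms(1) _ assms(5,6), where x = ?x]
    by (simp add: surrogate_cost_def[abs_def])
  \<comment> \<open>The offsets \<open>1 / 2\<close> cancel in the difference, and the expert point
    of \<open>a t\<close> is the played point.\<close>
  moreover have "(\<Sum>t=1..T. ?s t (?x t)) - (\<Sum>t=1..T. ?s t (expert_point M G a i t))
      = 2 * F * ((\<Sum>t=1..T. ?l t (a t)) - (\<Sum>t=1..T. ?l t i))"
    using \<open>0 < F\<close>
    unfolding sum_subtractf[symmetric] sum_distrib_left
    by (intro sum.cong) (simp_all add: played_point_def expert_loss_def field_simps)
  moreover have "Min ((\<lambda>b. \<Sum>t=1..T. ?l t b) ` {1..K}) \<le> (\<Sum>t=1..T. ?l t i)"
    using assms(11) by (intro Min_le) auto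
  then have "2 * F * ((\<Sum>t=1..T. ?l t (a t)) - (\<Sum>t=1..T. ?l t i)) \<le> 2 * F * expert_regret K T ?l a"
    using \<open>0 < F\<close> unfolding expert_regret_def by (intro mult_left_mono) auto
  \<comment> \<open>Both surrogate regrets subtract the same minimum over \<open>D\<close>, so they
    differ only by the cumulative costs compared above.\<close>
  ultimately show ?thesis by (simp add: oco_regret_def)
qed

end
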